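(* There exists a quasiconvex quadratic form $\Phi\colon\mathbb{R}^{3\times3}\to\mathbb{R}$ that is a weak extremal and such that the determinant $\det T(y)$ of its acoustic tensor $T(y)$ does not span an extreme ray of the cone of nonnegative ternary sextics.
   Context: A quadratic form $\Phi\colon\mathbb{R}^{3\times3}\to\mathbb{R}$ is quasiconvex if $0\le \int_{\mathbb{R}^3}\big(\Phi(Z+\nabla\varphi(x))-\Phi(Z)\big)\,dx$ for all $Z\in\mathbb{R}^{3\times 3}$ and all $\varphi\in C_c^\infty(\mathbb{R}^3,\mathbb{R}^3)$ (for quadratic forms this is equivalent to $\Phi(x\otimes y)\ge 0$ for all $x,y\in\mathbb{R}^3$, where $x\otimes y=xy^T$). A quasiconvex quadratic form $\Phi$ is a weak extremal if, for $M\in\mathbb{R}^{3\times3}$, the inequality $\Phi(x\otimes y)\ge\langle x,My\rangle^2$ for all $x,y\in\mathbb{R}^3$ implies $M=0$. The acoustic tensor (or $y$-matrix) of $\Phi$ is the symmetric $3\times3$ matrix $T(y)$, with entries quadratic forms in $y$, such that $\Phi(x\otimes y)=\langle x,T(y)x\rangle$ for all $x,y\in\mathbb{R}^3$. Its determinant is a ternary sextic, i.e. a homogeneous polynomial of degree $6$ in three variables. The cone of nonnegative ternary sextics consists of the real homogeneous polynomials $f$ of degree $6$ in three variables with $f\ge 0$ on $\mathbb{R}^3$. Such an $f$ spans an extreme ray if whenever $f=f_1+f_2$ with $f_1,f_2$ nonnegative ternary sextics, $f_1$ and $f_2$ are linearly dependent. *)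

theory Defs
  imports "HOL-Analysis.Analysis"
begin

definition quadratic_form :: "('a::real_vector \<Rightarrow> real) \<Rightarrow> bool" where
  "quadratic_form q \<longleftrightarrow> (\<exists>B. bilinear B \<and> (\<forall>z. q z = B z z))"

fun Ck_map :: "nat \<Rightarrow> ('a::euclidean_space \<Rightarrow> 'b::euclidean_space) \<Rightarrow> bool" where
  "Ck_map 0 f \<longleftrightarrow> continuous_on UNIV f"
| "Ck_map (Suc k) f \<longleftrightarrow>
     (\<forall>x. f differentiable (at x)) \<and> (\<forall>v. Ck_map k (\<lambda>x. frechet_derivative f (at x) v))"

definition test_map :: "('a::euclidean_space \<Rightarrow> 'b::euclidean_space) \<Rightarrow> bool" where
  "test_map f \<longleftrightarrow> (\<forall>k. Ck_map k f) \<and> compact (closure {x. f x \<noteq> 0})"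

text \<open>
  The matrix \<open>jacobian \<phi> (at x)\<close> has entry \<open>\<partial>\<^sub>j \<phi>\<^sub>i (x)\<close> in row \<open>i\<close> and column \<open>j\<close>. The integrand
  below is continuous with compact support, hence the Bochner integral is the usual one.
\<close>

definition quasiconvex :: "(real^3^3 \<Rightarrow> real) \<Rightarrow> bool" where
  "quasiconvex \<Phi> \<longleftrightarrow>
     (\<forall>Z. \<forall>\<phi> :: real^3 \<Rightarrow> real^3. test_map \<phi> \<longrightarrow>
        0 \<le> (LINT x|lborel. \<Phi> (Z + jacobian \<phi> (at x)) - \<Phi> Z))"

definition tensor :: "real^3 \<Rightarrow> real^3 \<Rightarrow> real^3^3" where
  "tensor x y = (\<chi> i j. x $ i * y $ j)"

definition weak_extremal :: "(real^3^3 \<Rightarrow> real) \<Rightarrow> bool" where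
  "weak_extremal \<Phi> \<longleftrightarrow>
     quadratic_form \<Phi> \<and> quasiconvex \<Phi> \<and>
     (\<forall>M :: real^3^3. (\<forall>x y. \<Phi> (tensor x y) \<ge> (x \<bullet> (M *v y))^2) \<longrightarrow> M = 0)"

definition is_acoustic_tensor :: "(real^3^3 \<Rightarrow> real) \<Rightarrow> (real^3 \<Rightarrow> real^3^3) \<Rightarrow> bool" where
  "is_acoustic_tensor \<Phi> T \<longleftrightarrow>
     (\<forall>y. transpose (T y) = T y) \<and>
     (\<forall>i j. quadratic_form (\<lambda>y. T y $ i $ j)) \<and>
     (\<forall>x y. \<Phi> (tensor x y) = x \<bullet> (T y *v x))"

lemma is_acoustic_tensor_unique:
  assumes "is_acoustic_tensor \<Phi> S" and "is_acoustic_tensor \<Phi> T"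
  shows "S = T"
proof
  fix y
  define D where "D = S y - T y"
  have sym: "D $ i $ j = D $ j $ i" for i j
    using assms unfolding is_acoustic_tensor_def D_def
    by (simp add: transpose_def vec_eq_iff)
  have q: "x \<bullet> (D *v x) = 0" for x
  proof -
    have "x \<bullet> (S y *v x) = x \<bullet> (T y *v x)"
      using assms unfolding is_acoustic_tensor_def by metis
    then show ?thesis
      by (simp add: D_def matrix_vector_mult_diff_rdistrib inner_diff_right)
  qed
  have e: "axis i 1 \<bullet> (D *v axis j 1) = D $ i $ j" for i j
    by (simp add: inner_axis' matrix_vector_mul_component inner_axis)
  have "D $ i $ j = 0" for i j
    using q[of "axis i 1 + axis j 1"] q[of "axis i 1"] q[of "axis j 1"] sym[of i j]
    by (simp add: e matrix_vector_right_distrib inner_add_left inner_add_right)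
  then show "S y = T y" by (simp add: D_def vec_eq_iff)
qed

text \<open>
  Forms of degree \<open>d\<close> are represented as polynomial functions, which determine the polynomial
  since the field is infinite. The sum ranges over the multi-indices of total degree \<open>d\<close>.
\<close>

definition homogeneous_poly :: "nat \<Rightarrow> (real^'n \<Rightarrow> real) \<Rightarrow> bool" where
  "homogeneous_poly d f \<longleftrightarrow>
     (\<exists>c :: ('n \<Rightarrow> nat) \<Rightarrow> real. \<forall>y.
        f y = (\<Sum>\<alpha> | (\<Sum>i\<in>UNIV. \<alpha> i) = d. c \<alpha> * (\<Prod>i\<in>UNIV. y $ i ^ \<alpha> i)))"

lemma finite_multi_indices: "finite {\<alpha> :: 'n::finite \<Rightarrow> nat. (\<Sum>i\<in>UNIV. \<alpha> i) = d}"
proof (rule finite_subset)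
  show "{\<alpha> :: 'n \<Rightarrow> nat. (\<Sum>i\<in>UNIV. \<alpha> i) = d} \<subseteq> (UNIV \<rightarrow>\<^sub>E {..d})"
    by (auto simp: PiE_UNIV_domain intro: member_le_sum)
  show "finite ((UNIV :: 'n set) \<rightarrow>\<^sub>E {..d})"
    by (intro finite_PiE) auto
qed

definition nonneg_ternary_sextic :: "(real^3 \<Rightarrow> real) \<Rightarrow> bool" where
  "nonneg_ternary_sextic f \<longleftrightarrow> homogeneous_poly 6 f \<and> (\<forall>y. f y \<ge> 0)"

definition lin_dependent :: "('a \<Rightarrow> real) \<Rightarrow> ('a \<Rightarrow> real) \<Rightarrow> bool" where
  "lin_dependent f g \<longleftrightarrow> (\<exists>a b :: real. (a \<noteq> 0 \<or> b \<noteq> 0) \<and> (\<forall>y. a * f y + b * g y = 0))"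

text \<open>
  To be read for \<open>f\<close> in the cone. A function that fails the condition is a sum of two members
  of the cone and so belongs to the cone itself: the negation never holds by default.
\<close>

definition spans_extreme_ray :: "(real^3 \<Rightarrow> real) \<Rightarrow> bool" where
  "spans_extreme_ray f \<longleftrightarrow>
     (\<forall>f1 f2. nonneg_ternary_sextic f1 \<and> nonneg_ternary_sextic f2 \<and> (\<forall>y. f y = f1 y + f2 y)
        \<longrightarrow> lin_dependent f1 f2)"

end

theory Submission
  imports Defs
begin

text \<open>
  A nonnegative biquadratic form \<open>\<Phi> (x \<otimes> y)\<close> whose zeros \<open>(x, y)\<close> have tensors \<open>x \<otimes> y\<close> spanning
  all \<open>3 \<times> 3\<close> matrices is a weak extremal, since \<open>\<langle>x, M y\<rangle>\<close> must vanish at every zero. This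
  needs only nine zeros. But through the nine points \<open>y\<close> there passes a cubic, and a small multiple
  of its square can be subtracted from the sextic \<open>det T(y)\<close>, which vanishes to second order at
  these points, without destroying nonnegativity. An explicit form with exactly nine such zeros
  therefore does the job.

  That nonnegativity on rank-one matrices implies quasiconvexity is shown by replacing the gradient
  with central differences: the integral becomes an average of sums over translates of a grid, and
  these are nonnegative by the discrete Parseval identity.
\<close>

subsection \<open>Discrete Parseval identity\<close>

definition grid_box :: "nat \<Rightarrow> ('n::finite \<Rightarrow> int) set" where
  "grid_box m = UNIV \<rightarrow>\<^sub>E {- int m..int m}"

lemma mem_grid_box: "n \<in> grid_box m \<longleftrightarrow> (\<forall>i. \<bar>n i\<bar> \<le> int m)"
proof -
  have "n \<in> grid_box m \<longleftrightarrow> (\<forall>i. n i \<in> {- int m..int m})"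
    by (auto simp: grid_box_def PiE_UNIV_domain Pi_iff)
  also have "\<dots> \<longleftrightarrow> (\<forall>i. \<bar>n i\<bar> \<le> int m)"
    by (intro iff_allI) auto
  finally show ?thesis .
qed

lemma finite_grid_box: "finite (grid_box m :: ('n::finite \<Rightarrow> int) set)"
  unfolding grid_box_def by (intro finite_PiE) auto

text \<open>Because \<open>\<bar>c\<bar> \<le> 1\<close>, the box of radius \<open>Suc m\<close>
  contains every point that the shift carries into the box of radius \<open>m\<close>. Its other
  points are carried to where \<open>g\<close> vanishes.\<close>

lemma sum_grid_box_shift:
  fixes g :: "('n::finite \<Rightarrow> int) \<Rightarrow> 'b::comm_monoid_add"
  assumes "\<And>n. n \<notin> grid_box m \<Longrightarrow> g n = 0" and "\<bar>c\<bar> \<le> 1"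
  shows "(\<Sum>n\<in>grid_box (Suc m). g (n(j := n j + c))) = (\<Sum>n\<in>grid_box m. g n)"
\<comment> \<open>\<open>S'\<close> collects the indices whose shift leaves the smaller box, where
  the summand is zero. Between the remaining indices and the smaller box the shift is a
  bijection.\<close>
proof (rule sum.reindex_bij_witness_not_neutral
    [where S' = "{n \<in> grid_box (Suc m). n(j := n j + c) \<notin> grid_box m}" and T' = "{}"
      and i = "\<lambda>n. n(j := n j - c)" and j = "\<lambda>n. n(j := n j + c)"])
  show "finite {n \<in> grid_box (Suc m). n(j := n j + c) \<notin> grid_box m}"
    by (rule finite_subset[OF _ finite_grid_box]) auto
next
  fix b :: "'n \<Rightarrow> int" assume "b \<in> grid_box m - {}"
  then have b: "\<bar>b i\<bar> \<le> int m" for i by (simp add: mem_grid_box)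
  have "\<bar>(b(j := b j - c)) i\<bar> \<le> int (Suc m)" for i
    using b[of i] assms(2) by auto
  moreover have "(b(j := b j - c))(j := (b(j := b j - c)) j + c) = b" by auto
  ultimately show "b(j := b j - c) \<in> grid_box (Suc m) - {n \<in> grid_box (Suc m). n(j := n j + c) \<notin> grid_box m}"
    using b by (simp add: mem_grid_box)
qed (use assms in auto)

text \<open>A geometric series in an \<open>N\<close>-th root of unity. The bound on
  \<open>d\<close> prevents a nonzero \<open>d\<close> from being a multiple of \<open>N\<close>, so
  the root differs from 1 and the series sums to zero.\<close>

lemma sum_cis_int_multiples:
  fixes d :: int
  assumes "\<bar>d\<bar> < int N"
  shows "(\<Sum>k<N. cis (2 * pi / N * real k * d)) = (if d = 0 then of_nat N else 0)"
proof (cases "d = 0")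
  case False
  let ?z = "cis (2 * pi / N * d)"
  have N: "N > 0" using assms by auto
  have eq: "cis (2 * pi / N * real k * d) = ?z ^ k" for k
    by (simp add: Complex.DeMoivre mult_ac)
  have "?z ^ N = cis (2 * pi * d)" using N by (simp add: Complex.DeMoivre)
  also have "\<dots> = 1" by (rule cis_multiple_2pi) auto
  finally have zN: "?z ^ N = 1" .
  have "?z \<noteq> 1"
  proof
    assume "?z = 1"
    then have "cos (2 * pi / N * d) = 1" by (metis cis.sel(1) one_complex.sel(1))
    then obtain m :: int where "2 * pi / N * d = m * (2 * pi)"
      by (auto simp: cos_one_2pi_int)
    then have "real_of_int d = real_of_int (m * int N)" using N by (simp add: field_simps)
    then have "d = m * int N" by linarith
    then have "int N dvd d" by simp
    then show False using assms False dvd_imp_le_int[of d "int N"] by simp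
  qed
  then show ?thesis using False zN unfolding eq by (simp add: sum_gp_strict)
qed simp

text \<open>The argument of the discrete Fourier character with frequency \<open>k\<close> at the
  lattice point \<open>n\<close>. Cosine and sine of it replace the complex exponential, so that
  everything stays in real vector spaces.\<close>

definition phase :: "nat \<Rightarrow> ('n::finite \<Rightarrow> nat) \<Rightarrow> ('n \<Rightarrow> int) \<Rightarrow> real" where
  "phase N k n = (\<Sum>i\<in>UNIV. 2 * pi / N * real (k i) * of_int (n i))"

lemma phase_shift: "phase N k (n(j := n j + c)) = phase N k n + 2 * pi / N * real (k j) * of_int c"
proof -
  have "phase N k (n(j := n j + c)) =
     (\<Sum>i\<in>UNIV. 2 * pi / N * real (k i) * of_int (n i) + (if i = j then 2 * pi / N * real (k j) * of_int c else 0))"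
    unfolding phase_def by (intro sum.cong) (auto simp: algebra_simps add_divide_distrib)
  then show ?thesis by (simp add: phase_def sum.distrib)
qed

text \<open>Orthogonality of characters: the sum over all frequencies factors into one-dimensional
  geometric sums. Since \<open>2 * m < N\<close>, two points of the box that agree modulo
  \<open>N\<close> in every coordinate are equal, so there is no aliasing.\<close>

lemma sum_cos_phase:
  fixes n n' :: "'n::finite \<Rightarrow> int"
  assumes "n \<in> grid_box m" "n' \<in> grid_box m" "2 * m < N"
  shows "(\<Sum>k\<in>UNIV \<rightarrow>\<^sub>E {..<N}. cos (phase N k n - phase N k n')) = (if n = n' then real N ^ CARD('n) else 0)"
proof -
  have d: "\<bar>n i - n' i\<bar> < int N" for i
  proof -
    have "\<bar>n i\<bar> \<le> int m" "\<bar>n' i\<bar> \<le> int m" using assms by (auto simp: mem_grid_box)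
    then show ?thesis using assms(3) by linarith
  qed
  have cis_sum: "cis (\<Sum>i\<in>I. f i) = (\<Prod>i\<in>I. cis (f i))" if "finite I" for f and I :: "'n set"
    using that by (induction I) (auto simp: cis_mult[symmetric])
  have "(\<Sum>k\<in>UNIV \<rightarrow>\<^sub>E {..<N}. cis (phase N k n - phase N k n')) =
      (\<Sum>k\<in>UNIV \<rightarrow>\<^sub>E {..<N}. \<Prod>i\<in>UNIV. cis (2 * pi / N * real (k i) * of_int (n i - n' i)))"
    unfolding phase_def by (intro sum.cong) (simp_all add: cis_sum[symmetric] sum_subtractf[symmetric] right_diff_distrib diff_divide_distrib)
  also have "\<dots> = (\<Prod>i\<in>UNIV. \<Sum>k<N. cis (2 * pi / N * real k * of_int (n i - n' i)))"
    by (rule prod_sum_PiE[symmetric]) auto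
  also have "\<dots> = (\<Prod>i\<in>UNIV. if n i = n' i then of_nat N else 0)"
    by (subst sum_cis_int_multiples[OF d]) simp
  also have "\<dots> = (if n = n' then of_nat N ^ CARD('n) else 0)"
    by (auto simp: fun_eq_iff)
  finally have "Re (\<Sum>k\<in>UNIV \<rightarrow>\<^sub>E {..<N}. cis (phase N k n - phase N k n')) =
     Re (if n = n' then of_nat N ^ CARD('n) else 0)" by simp
  then show ?thesis by (auto simp flip: of_nat_power)
qed

text \<open>Expanding both bilinear terms and using the formula for the cosine of a difference gives
  a double sum over \<open>n\<close> and \<open>n'\<close>. Orthogonality then leaves only its
  diagonal.\<close>

lemma discrete_parseval:
  fixes u v :: "('n::finite \<Rightarrow> int) \<Rightarrow> 'a::real_vector" and B :: "'a \<Rightarrow> 'a \<Rightarrow> real"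
  assumes B: "bilinear B" and N: "2 * m < N"
  shows "(\<Sum>k\<in>UNIV \<rightarrow>\<^sub>E {..<N}.
            B (\<Sum>n\<in>grid_box m. cos (phase N k n) *\<^sub>R u n) (\<Sum>n\<in>grid_box m. cos (phase N k n) *\<^sub>R v n) +
            B (\<Sum>n\<in>grid_box m. sin (phase N k n) *\<^sub>R u n) (\<Sum>n\<in>grid_box m. sin (phase N k n) *\<^sub>R v n))
         = real N ^ CARD('n) * (\<Sum>n\<in>grid_box m. B (u n) (v n))" (is "?L = _")
proof -
  have "?L = (\<Sum>k\<in>UNIV \<rightarrow>\<^sub>E {..<N}. \<Sum>n\<in>grid_box m. \<Sum>n'\<in>grid_box m.
                cos (phase N k n - phase N k n') * B (u n) (v n'))"
    using finite_grid_box[of m]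
    by (simp only: bilinear_sum[OF B] sum.cartesian_product' sum.distrib[symmetric] bilinear_lmul[OF B]
       bilinear_rmul[OF B] cos_diff)
       (simp add: algebra_simps split_def)
  also have "\<dots> = (\<Sum>n\<in>grid_box m. \<Sum>k\<in>UNIV \<rightarrow>\<^sub>E {..<N}. \<Sum>n'\<in>grid_box m.
                cos (phase N k n - phase N k n') * B (u n) (v n'))"
    by (rule sum.swap)
  also have "\<dots> = (\<Sum>n\<in>grid_box m. \<Sum>n'\<in>grid_box m. \<Sum>k\<in>UNIV \<rightarrow>\<^sub>E {..<N}.
                cos (phase N k n - phase N k n') * B (u n) (v n'))"
    by (intro sum.cong refl sum.swap)
  also have "\<dots> = (\<Sum>n\<in>grid_box m. \<Sum>n'\<in>grid_box m.
                (if n = n' then real N ^ CARD('n) else 0) * B (u n) (v n'))"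
    by (intro sum.cong refl) (simp add: sum_cos_phase[OF _ _ N] flip: sum_distrib_right)
  also have "\<dots> = (\<Sum>n\<in>grid_box m. real N ^ CARD('n) * B (u n) (v n))"
    by (intro sum.cong refl) (simp add: if_distrib[of "\<lambda>x. x * _"] finite_grid_box cong: if_cong)
  finally show ?thesis by (simp add: sum_distrib_left)
qed

section \<open>Summation by parts and nonnegativity for discrete gradients\<close>

definition grid_gradient :: "((3 \<Rightarrow> int) \<Rightarrow> real^3) \<Rightarrow> (3 \<Rightarrow> int) \<Rightarrow> real^3^3" where
  "grid_gradient u n = (\<chi> i j. u (n(j := n j + 1)) $ i - u (n(j := n j - 1)) $ i)"

text \<open>Summation by parts: the central difference moves from \<open>u\<close> to the weight
  with reversed sign. The left sum needs one extra layer, since differences of \<open>u\<close> can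
  be nonzero one step outside its support.\<close>

lemma sum_grid_gradient:
  assumes supp: "\<And>n. n \<notin> grid_box m \<Longrightarrow> u n = 0"
  shows "(\<Sum>n\<in>grid_box (Suc m). w n *\<^sub>R grid_gradient u n) =
     (\<chi> i j. \<Sum>n\<in>grid_box m. (w (n(j := n j - 1)) - w (n(j := n j + 1))) * u n $ i)"
proof -
  have "(\<Sum>n\<in>grid_box (Suc m). w n * (u (n(j := n j + 1)) $ i - u (n(j := n j - 1)) $ i)) =
     (\<Sum>n\<in>grid_box m. (w (n(j := n j - 1)) - w (n(j := n j + 1))) * u n $ i)" for i j
  proof -
    have 1: "(\<Sum>n\<in>grid_box (Suc m). w n * u (n(j := n j + 1)) $ i) =
       (\<Sum>n\<in>grid_box m. w (n(j := n j - 1)) * u n $ i)"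
      using sum_grid_box_shift[of m "\<lambda>n. w (n(j := n j - 1)) * u n $ i" 1 j] supp by simp
    have 2: "(\<Sum>n\<in>grid_box (Suc m). w n * u (n(j := n j - 1)) $ i) =
       (\<Sum>n\<in>grid_box m. w (n(j := n j + 1)) * u n $ i)"
      using sum_grid_box_shift[of m "\<lambda>n. w (n(j := n j + 1)) * u n $ i" "-1" j] supp by simp
    show ?thesis by (simp only: right_diff_distrib left_diff_distrib sum_subtractf 1 2)
  qed
  then show ?thesis by (simp add: vec_eq_iff grid_gradient_def)
qed

lemma sum_grid_gradient_eq_0:
  assumes "\<And>n. n \<notin> grid_box m \<Longrightarrow> u n = 0"
  shows "(\<Sum>n\<in>grid_box (Suc m). grid_gradient u n) = 0"
  using sum_grid_gradient[OF assms, where w = "\<lambda>_. 1"] by (simp add: vec_eq_iff)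

text \<open>
  The symbol of a central difference is purely imaginary, so each Fourier mode of the discrete
  gradient splits into two real rank-one matrices; one-sided differences would not do.
\<close>

lemma grid_rank_one_nonneg:
  fixes B :: "real^3^3 \<Rightarrow> real^3^3 \<Rightarrow> real"
  assumes B: "bilinear B" and pos: "\<And>x y. 0 \<le> B (tensor x y) (tensor x y)"
    and supp: "\<And>n. n \<notin> grid_box m \<Longrightarrow> u n = 0"
  shows "0 \<le> (\<Sum>n\<in>grid_box (Suc m). B (grid_gradient u n) (grid_gradient u n))"
proof -
  \<comment> \<open>The sums of the discrete gradient run over the box of radius
    \<open>Suc m\<close>; this is the least \<open>N\<close> for which
    \<open>discrete_parseval\<close> applies there.\<close>
  define N where "N = 2 * Suc m + 1"
  \<comment> \<open>Up to the imaginary unit, this is the symbol of the central differences at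
    frequency \<open>k\<close>.\<close>
  define s :: "(3 \<Rightarrow> nat) \<Rightarrow> real^3" where "s k = (\<chi> j. 2 * sin (2 * pi / N * real (k j)))" for k
  let ?g = "grid_gradient u"
  have c: "(\<Sum>n\<in>grid_box (Suc m). cos (phase N k n) *\<^sub>R ?g n) =
     tensor (\<Sum>n\<in>grid_box m. sin (phase N k n) *\<^sub>R u n) (s k)" for k
  proof -
    have e: "cos (phase N k (n(j := n j - 1))) - cos (phase N k (n(j := n j + 1))) = sin (phase N k n) * s k $ j" for n j
      using phase_shift[of N k n j 1] phase_shift[of N k n j "-1"]
      by (simp add: s_def cos_add cos_diff)
    show ?thesis
      by (subst sum_grid_gradient[OF supp], assumption, unfold e tensor_def)
        (simp add: vec_eq_iff sum_distrib_left mult_ac)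
  qed
  have d: "(\<Sum>n\<in>grid_box (Suc m). sin (phase N k n) *\<^sub>R ?g n) =
     tensor (\<Sum>n\<in>grid_box m. cos (phase N k n) *\<^sub>R u n) (- s k)" for k
  proof -
    \<comment> \<open>The difference of sines produces the opposite sign to the cosine case; it is
      absorbed into the second factor of the tensor product.\<close>
    have e: "sin (phase N k (n(j := n j - 1))) - sin (phase N k (n(j := n j + 1))) = cos (phase N k n) * (- s k) $ j" for n j
      using phase_shift[of N k n j 1] phase_shift[of N k n j "-1"]
      by (simp add: s_def sin_add sin_diff)
    show ?thesis
      by (subst sum_grid_gradient[OF supp], assumption, unfold e tensor_def)
        (simp add: vec_eq_iff sum_distrib_left mult_ac)
  qed
  have "0 \<le> (\<Sum>k\<in>UNIV \<rightarrow>\<^sub>E {..<N}.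
      B (\<Sum>n\<in>grid_box (Suc m). cos (phase N k n) *\<^sub>R ?g n) (\<Sum>n\<in>grid_box (Suc m). cos (phase N k n) *\<^sub>R ?g n) +
      B (\<Sum>n\<in>grid_box (Suc m). sin (phase N k n) *\<^sub>R ?g n) (\<Sum>n\<in>grid_box (Suc m). sin (phase N k n) *\<^sub>R ?g n))"
    unfolding c d by (intro sum_nonneg add_nonneg_nonneg pos)
  also have "\<dots> = real N ^ CARD(3) * (\<Sum>n\<in>grid_box (Suc m). B (?g n) (?g n))"
    by (rule discrete_parseval[OF B]) (simp add: N_def)
  finally show ?thesis by (simp add: N_def zero_le_mult_iff)
qed

subsection \<open>Quasiconvexity from rank-one nonnegativity\<close>

definition lattice_point :: "real \<Rightarrow> ('n::finite \<Rightarrow> int) \<Rightarrow> real^'n" where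
  "lattice_point h n = (\<chi> i. h * of_int (n i))"

lemma lattice_point_shift:
  "lattice_point h (n(j := n j + c)) = lattice_point h n + (h * of_int c) *\<^sub>R axis j 1"
  by (simp add: vec_eq_iff lattice_point_def axis_def algebra_simps)

lemma integrable_continuous_compact_support:
  fixes F :: "'a::euclidean_space \<Rightarrow> real"
  assumes "continuous_on UNIV F" "compact K" and supp: "\<And>x. x \<notin> K \<Longrightarrow> F x = 0"
  shows "integrable lborel F"
proof -
  have "integrable lborel (\<lambda>x. indicator K x *\<^sub>R F x)"
    using assms by (intro borel_integrable_compact) (auto intro: continuous_on_subset)
  also have "(\<lambda>x. indicator K x *\<^sub>R F x) = F"
    using supp by (auto simp: indicator_def fun_eq_iff)
  finally show ?thesis .
qed

lemma lborel_translate: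
  fixes f :: "'a::euclidean_space \<Rightarrow> real"
  assumes "f \<in> borel_measurable borel"
  shows "integrable lborel (\<lambda>x. f (c + x)) \<longleftrightarrow> integrable lborel f"
    and "(LINT x|lborel. f (c + x)) = (LINT x|lborel. f x)"
  using integrable_distr_eq[of "\<lambda>x. c + x" lborel borel f] integral_distr[of "\<lambda>x. c + x" lborel borel f] assms
  by (simp_all add: lborel_distr_plus)

text \<open>Space is cut into translates of one cube of side \<open>h\<close>, and each piece is
  translated back to that cube. The integral becomes the integral over the cube of the sums in
  \<open>pos\<close>. The condition on \<open>m\<close> ensures that the box indexes every cube on
  which \<open>F\<close> is not identically zero.\<close>

lemma integral_nonneg_lattice:
  fixes F :: "real^'n \<Rightarrow> real"
  assumes cont: "continuous_on UNIV F" and h: "h > 0" and m: "R + h \<le> h * real m"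
    and supp: "\<And>x i. \<bar>x $ i\<bar> > R \<Longrightarrow> F x = 0"
    and pos: "\<And>x. (\<And>i. 0 \<le> x $ i) \<Longrightarrow> (\<And>i. x $ i < h) \<Longrightarrow>
       0 \<le> (\<Sum>n\<in>grid_box m. F (x + lattice_point h n))"
  shows "0 \<le> (LINT x|lborel. F x)"
proof -
  \<comment> \<open>Half-open, so that the translates tile the space without overlap and no boundary
    sets need separate treatment.\<close>
  define cell :: "(real^'n) set" where "cell = {x. \<forall>i. 0 \<le> x $ i \<and> x $ i < h}"
  have "cell = (\<Inter>i. {x. 0 \<le> x $ i} \<inter> {x. x $ i < h})" by (auto simp: cell_def)
  also have "\<dots> \<in> sets borel"
    by (intro sets.finite_INT sets.Int borel_closed borel_open closed_Collect_le open_Collect_less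
        continuous_intros) auto
  finally have cell[measurable]: "cell \<in> sets borel" .
  have Fm[measurable]: "F \<in> borel_measurable borel"
    using cont by (rule borel_measurable_continuous_onI)
  have int: "integrable lborel F"
  proof (rule integrable_continuous_compact_support[OF cont, of "cbox (\<chi> i. - R) (\<chi> i. R)"])
    fix x :: "real^'n" assume "x \<notin> cbox (\<chi> i. - R) (\<chi> i. R)"
    then obtain i where "\<not> (- R \<le> x $ i \<and> x $ i \<le> R)" by (auto simp: mem_box_cart)
    then have "\<bar>x $ i\<bar> > R" by linarith
    then show "F x = 0" by (rule supp)
  qed auto
  define G where "G n x = indicator cell (x - lattice_point h n) * F x" for n x
  have "F x = (\<Sum>n\<in>grid_box m. G n x)" for x
  proof (cases "F x = 0")
    case False
    \<comment> \<open>The index of the unique cell containing \<open>x\<close>. Rounding down can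
      raise the absolute value by up to 1, which accounts for the bound \<open>real m - 1\<close>
      below.\<close>
    define n where "n i = \<lfloor>x $ i / h\<rfloor>" for i
    have R: "\<bar>x $ i\<bar> \<le> R" for i using supp[of x i] False by force
    have "n \<in> grid_box m" unfolding mem_grid_box
    proof
      fix i
      have "\<bar>x $ i\<bar> / h \<le> R / h" using R h by (simp add: divide_right_mono)
      also have "\<dots> \<le> real m - 1" using m h by (simp add: field_simps)
      finally have "\<bar>x $ i / h\<bar> \<le> real m - 1" using h by simp
      then show "\<bar>n i\<bar> \<le> int m" unfolding n_def by linarith
    qed
    moreover have "x - lattice_point h k \<in> cell \<longleftrightarrow> k = n" for k
    proof -
      have "x - lattice_point h k \<in> cell \<longleftrightarrow> (\<forall>i. of_int (k i) \<le> x $ i / h \<and> x $ i / h < of_int (k i) + 1)"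
        using h by (simp add: cell_def lattice_point_def field_simps)
      also have "\<dots> \<longleftrightarrow> (\<forall>i. \<lfloor>x $ i / h\<rfloor> = k i)" by (simp add: floor_eq_iff)
      finally show ?thesis by (auto simp: n_def fun_eq_iff)
    qed
    ultimately show ?thesis
      by (simp add: G_def indicator_def if_distrib[of "\<lambda>x. x * _"] finite_grid_box cong: if_cong)
  qed (simp add: G_def)
  then have "(LINT x|lborel. F x) = (LINT x|lborel. (\<Sum>n\<in>grid_box m. G n x))" by simp
  also have "\<dots> = (\<Sum>n\<in>grid_box m. LINT x|lborel. G n x)"
  proof (rule Bochner_Integration.integral_sum)
    fix n
    have "(\<lambda>x. x - lattice_point h n) -` cell \<in> sets borel"
      using measurable_sets[of "\<lambda>x. x - lattice_point h n" borel borel cell] by simp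
    then have "integrable lborel (\<lambda>x. indicator ((\<lambda>x. x - lattice_point h n) -` cell) x *\<^sub>R F x)"
      by (intro integrable_mult_indicator int) simp
    then show "integrable lborel (G n)"
      by (simp add: G_def[abs_def] indicator_def)
  qed
  also have "\<dots> = (\<Sum>n\<in>grid_box m. LINT x|lborel. indicator cell x * F (x + lattice_point h n))"
  proof (intro sum.cong refl)
    fix n
    have "G n \<in> borel_measurable borel" unfolding G_def by measurable
    from lborel_translate(2)[OF this, of "lattice_point h n"]
    show "(LINT x|lborel. G n x) = (LINT x|lborel. indicator cell x * F (x + lattice_point h n))"
      by (simp add: G_def add.commute)
  qed
  also have "\<dots> = (LINT x|lborel. (\<Sum>n\<in>grid_box m. indicator cell x * F (x + lattice_point h n)))"
  proof (rule Bochner_Integration.integral_sum[symmetric])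
    fix n
    have "integrable lborel (\<lambda>x. F (x + lattice_point h n))"
      using lborel_translate(1)[OF Fm, of "lattice_point h n"] int by (simp add: add.commute)
    then show "integrable lborel (\<lambda>x. indicator cell x * F (x + lattice_point h n))"
      using integrable_mult_indicator[of cell lborel "\<lambda>x. F (x + lattice_point h n)"] by simp
  qed
  also have "\<dots> \<ge> 0"
    unfolding sum_distrib_left[symmetric]
    by (intro Bochner_Integration.integral_nonneg) (auto simp: indicator_def cell_def intro!: pos)
  finally show ?thesis .
qed

section \<open>Gradients by central differences\<close>

definition central_gradient :: "real \<Rightarrow> (real^3 \<Rightarrow> real^3) \<Rightarrow> real^3 \<Rightarrow> real^3^3" where
  "central_gradient h \<phi> x = (\<chi> i j. (\<phi> (x + h *\<^sub>R axis j 1) - \<phi> (x - h *\<^sub>R axis j 1)) $ i / (2 * h))"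

lemma central_gradient_lattice:
  "central_gradient h \<phi> (x + lattice_point h n) =
     (1 / (2 * h)) *\<^sub>R grid_gradient (\<lambda>n. \<phi> (x + lattice_point h n)) n"
proof -
  have shift: "x + lattice_point h n + h *\<^sub>R axis j 1 = x + lattice_point h (n(j := n j + 1))"
    and shift': "x + lattice_point h n - h *\<^sub>R axis j 1 = x + lattice_point h (n(j := n j - 1))" for j
    using lattice_point_shift[of h n j 1] lattice_point_shift[of h n j "-1"] by simp_all
  then show ?thesis
    unfolding central_gradient_def grid_gradient_def shift shift' by (simp add: vec_eq_iff)
qed

lemma continuous_on_central_gradient:
  assumes "continuous_on UNIV \<phi>"
  shows "continuous_on UNIV (central_gradient h \<phi>)"
  unfolding central_gradient_def divide_inverse
  by (intro continuous_intros continuous_on_compose2[OF assms]) auto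

text \<open>The integrand is the increment at \<open>Z\<close> of the quadratic form of
  \<open>B\<close>. On each translated lattice the terms linear in the gradient cancel, because
  discrete gradients of finitely supported functions sum to zero. The quadratic term is handled by
  \<open>grid_rank_one_nonneg\<close>.\<close>

lemma integral_central_gradient_nonneg:
  fixes B :: "real^3^3 \<Rightarrow> real^3^3 \<Rightarrow> real"
  assumes B: "bilinear B" and pos: "\<And>x y. 0 \<le> B (tensor x y) (tensor x y)"
    and cont: "continuous_on UNIV \<phi>" and h: "h > 0"
    and supp: "\<And>x i. \<bar>x $ i\<bar> > R \<Longrightarrow> \<phi> x = 0"
  shows "0 \<le> (LINT x|lborel. B Z (central_gradient h \<phi> x) + B (central_gradient h \<phi> x) Z
             + B (central_gradient h \<phi> x) (central_gradient h \<phi> x))"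
proof -
  let ?D = "central_gradient h \<phi>"
  obtain m :: nat where m: "\<bar>R\<bar> / h + 2 < real m" using reals_Archimedean2 by blast
  have mR: "\<bar>R\<bar> + 2 * h < h * m" using m h by (simp add: field_simps)
  note bb = bilinear_conv_bounded_bilinear[THEN iffD1, OF B]
  show ?thesis
  \<comment> \<open>Central differences reach a distance \<open>h\<close> beyond the support of
    \<open>\<phi>\<close>. Hence the radius \<open>R + h\<close> and one layer more than the box of
    radius \<open>m\<close> outside which the sampled function vanishes.\<close>
  proof (rule integral_nonneg_lattice[where R = "R + h" and h = h and m = "Suc m"])
    show "continuous_on UNIV (\<lambda>x. B Z (?D x) + B (?D x) Z + B (?D x) (?D x))"
      by (intro continuous_intros bounded_bilinear.continuous_on[OF bb] continuous_on_central_gradient cont)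
    show "R + h + h \<le> h * real (Suc m)" using mR h by (simp add: algebra_simps)
    show "B Z (?D x) + B (?D x) Z + B (?D x) (?D x) = 0" if x: "R + h < \<bar>x $ i\<bar>" for x i
    proof -
      have "\<phi> (x + h *\<^sub>R axis j 1) = 0" "\<phi> (x - h *\<^sub>R axis j 1) = 0" for j
        using x h by (auto intro!: supp[where i = i] simp: axis_def)
      then have "?D x = 0" by (simp add: central_gradient_def vec_eq_iff)
      then show ?thesis by (simp add: bilinear_lzero[OF B] bilinear_rzero[OF B])
    qed
    fix x :: "real^3"
    assume x: "\<And>i. 0 \<le> x $ i" "\<And>i. x $ i < h"
    define u where "u n = \<phi> (x + lattice_point h n)" for n
    have u: "u n = 0" if n: "n \<notin> grid_box m" for n
    proof -
      obtain i where "int m < \<bar>n i\<bar>" using n by (auto simp: mem_grid_box not_le)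
      then have "real m + 1 \<le> \<bar>of_int (n i)\<bar>" by linarith
      then have "h * (real m + 1) \<le> \<bar>h * of_int (n i)\<bar>" using h by (simp add: abs_mult)
      then have "R < \<bar>(x + lattice_point h n) $ i\<bar>"
        using x[of i] mR h by (simp add: lattice_point_def algebra_simps)
      then show ?thesis unfolding u_def by (rule supp)
    qed
    let ?g = "grid_gradient u" and ?S = "grid_box (Suc m)" and ?c = "1 / (2 * h)"
    have D: "?D (x + lattice_point h n) = ?c *\<^sub>R ?g n" for n
      unfolding central_gradient_lattice u_def ..
    have "linear (B Z)" "linear (\<lambda>A. B A Z)" using B by (simp_all add: bilinear_def)
    from this[THEN linear_sum, of ?g ?S]
    have "(\<Sum>n\<in>?S. B Z (?g n)) = 0" "(\<Sum>n\<in>?S. B (?g n) Z) = 0"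
      by (simp_all add: sum_grid_gradient_eq_0[OF u] bilinear_lzero[OF B] bilinear_rzero[OF B])
    moreover have "(\<Sum>n\<in>?S. B Z (c *\<^sub>R ?g n) + B (c *\<^sub>R ?g n) Z + B (c *\<^sub>R ?g n) (c *\<^sub>R ?g n))
      = c * (\<Sum>n\<in>?S. B Z (?g n)) + c * (\<Sum>n\<in>?S. B (?g n) Z) + c * (c * (\<Sum>n\<in>?S. B (?g n) (?g n)))" for c
      by (simp only: bilinear_lmul[OF B] bilinear_rmul[OF B] real_scaleR_def sum.distrib sum_distrib_left)
    ultimately have "(\<Sum>n\<in>?S. B Z (?c *\<^sub>R ?g n) + B (?c *\<^sub>R ?g n) Z + B (?c *\<^sub>R ?g n) (?c *\<^sub>R ?g n))
      = ?c * (?c * (\<Sum>n\<in>?S. B (?g n) (?g n)))"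
      by (simp only: mult_zero_right add_0_left)
    also have "\<dots> \<ge> 0"
      using grid_rank_one_nonneg[OF B pos u] h by simp
    finally show "0 \<le> (\<Sum>n\<in>?S. B Z (?D (x + lattice_point h n)) + B (?D (x + lattice_point h n)) Z
             + B (?D (x + lattice_point h n)) (?D (x + lattice_point h n)))"
      unfolding D .
  qed (use h in auto)
qed

section \<open>Passage to the limit of vanishing step size\<close>

lemma vanishes_outside_cube:
  fixes \<phi> :: "real^'n \<Rightarrow> 'b::zero"
  assumes "compact (closure {x. \<phi> x \<noteq> 0})"
  obtains R where "\<And>x i. \<bar>x $ i\<bar> > R \<Longrightarrow> \<phi> x = 0"
proof -
  have "bounded {x. \<phi> x \<noteq> 0}"
    using assms by (meson bounded_subset closure_subset compact_imp_bounded)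
  then obtain R where R: "\<And>x. \<phi> x \<noteq> 0 \<Longrightarrow> norm x \<le> R"
    by (auto simp: bounded_iff)
  show thesis
  proof
    fix x :: "real^'n" and i assume "\<bar>x $ i\<bar> > R"
    then have "norm x > R" using component_le_norm_cart[of x i] by simp
    then show "\<phi> x = 0" using R[of x] by force
  qed
qed

lemma jacobian_component:
  "jacobian \<phi> (at x) $ i $ j = frechet_derivative \<phi> (at x) (axis j 1) $ i"
  by (simp add: jacobian_def matrix_def)

lemma has_vector_derivative_line:
  assumes "\<phi> differentiable (at (x + t *\<^sub>R v))"
  shows "((\<lambda>t. \<phi> (x + t *\<^sub>R v)) has_vector_derivative frechet_derivative \<phi> (at (x + t *\<^sub>R v)) v) (at t within S)"
proof -
  let ?D = "frechet_derivative \<phi> (at (x + t *\<^sub>R v))"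
  have D: "(\<phi> has_derivative ?D) (at (x + t *\<^sub>R v))"
    using assms by (simp add: frechet_derivative_works)
  have "((\<lambda>t. x + t *\<^sub>R v) has_vector_derivative v) (at t within S)"
    by (auto intro!: derivative_eq_intros)
  from vector_derivative_diff_chain_within[OF this, of \<phi> ?D] D
  show ?thesis by (auto simp: o_def intro: has_derivative_at_withinI)
qed

text \<open>A central difference quotient is the mean of a forward and a backward quotient, and both
  converge to the same partial derivative.\<close>

lemma central_gradient_tendsto:
  assumes diff: "\<phi> differentiable (at x)" and h: "h \<longlonglongrightarrow> 0" "\<And>n. h n > 0"
  shows "(\<lambda>n. central_gradient (h n) \<phi> x) \<longlonglongrightarrow> jacobian \<phi> (at x)"
proof (intro vec_tendstoI)
  fix i j
  define g where "g t = \<phi> (x + t *\<^sub>R axis j 1) $ i" for t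
  have "(g has_vector_derivative frechet_derivative \<phi> (at x) (axis j 1) $ i) (at 0)"
    unfolding g_def using has_vector_derivative_line[of \<phi> x 0 "axis j 1" UNIV] diff
    by (auto intro: bounded_linear.has_vector_derivative[OF bounded_linear_vec_nth])
  then have g: "(g has_real_derivative jacobian \<phi> (at x) $ i $ j) (at 0)"
    by (simp add: has_real_derivative_iff_has_vector_derivative jacobian_component)
  have q: "(\<lambda>t. (g t - g 0) / t) \<midarrow>0\<rightarrow> jacobian \<phi> (at x) $ i $ j"
    using g by (simp add: has_field_derivative_iff)
  have hp: "filterlim h (at 0) sequentially"
    using h by (simp add: filterlim_at less_imp_neq[symmetric])
  have hm: "filterlim (\<lambda>n. - h n) (at 0) sequentially"
    using h tendsto_minus[OF h(1)] by (simp add: filterlim_at less_imp_neq[symmetric])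
  have "(\<lambda>n. ((g (h n) - g 0) / h n + (g (- h n) - g 0) / (- h n)) / 2) \<longlonglongrightarrow>
      (jacobian \<phi> (at x) $ i $ j + jacobian \<phi> (at x) $ i $ j) / 2"
    by (intro tendsto_intros filterlim_compose[OF q hp] filterlim_compose[OF q hm]) auto
  moreover have "((g (h n) - g 0) / h n + (g (- h n) - g 0) / (- h n)) / 2 =
      central_gradient (h n) \<phi> x $ i $ j" for n
    using h(2)[of n] by (simp add: central_gradient_def g_def field_simps)
  ultimately show "(\<lambda>n. central_gradient (h n) \<phi> x $ i $ j) \<longlonglongrightarrow> jacobian \<phi> (at x) $ i $ j"
    by simp
qed

text \<open>The mean value inequality on the segment between the two sample points. For
  \<open>h \<le> 1\<close> all these segments lie in the compact sum \<open>K'\<close> of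
  \<open>K\<close> and the unit ball, where the partial derivatives are bounded; the bound is
  therefore uniform in \<open>h\<close> and serves for dominated convergence.\<close>

lemma central_gradient_bounded:
  assumes diff: "\<And>x. \<phi> differentiable (at x)"
    and cont: "\<And>v. continuous_on UNIV (\<lambda>x. frechet_derivative \<phi> (at x) v)"
    and K: "compact K"
  shows "\<exists>C. \<forall>x\<in>K. \<forall>h. 0 < h \<longrightarrow> h \<le> 1 \<longrightarrow> norm (central_gradient h \<phi> x) \<le> C"
proof -
  define K' where "K' = (\<lambda>(x, y). x + y) ` (K \<times> cball 0 1)"
  have K': "compact K'" unfolding K'_def case_prod_beta
    by (intro compact_continuous_image continuous_intros compact_Times K compact_cball)
  have "\<exists>C. \<forall>x\<in>K'. norm (frechet_derivative \<phi> (at x) (axis j 1)) \<le> C" for j :: 3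
  proof -
    have "compact ((\<lambda>x. frechet_derivative \<phi> (at x) (axis j 1)) ` K')"
      by (intro compact_continuous_image K' continuous_on_subset[OF cont]) auto
    then show ?thesis using compact_imp_bounded by (fastforce simp: bounded_iff)
  qed
  then obtain C where C: "\<And>x j. x \<in> K' \<Longrightarrow> norm (frechet_derivative \<phi> (at x) (axis j 1)) \<le> C j"
    by metis
  have "\<bar>central_gradient h \<phi> x $ i $ j\<bar> \<le> C j" if x: "x \<in> K" and h: "0 < h" "h \<le> 1" for x h i j
  proof -
    let ?e = "axis j 1 :: real^3"
    have mem: "x + t *\<^sub>R ?e \<in> K'" if "t \<in> {-h..h}" for t
    proof -
      have "t *\<^sub>R ?e \<in> cball 0 1" using that h by (simp add: abs_le_iff)
      then show ?thesis unfolding K'_def using x by force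
    qed
    have "norm (\<phi> (x + h *\<^sub>R ?e) - \<phi> (x + (- h) *\<^sub>R ?e)) \<le> C j * norm (h - (- h))"
    proof (rule differentiable_bound[where S = "{-h..h}"])
      fix t assume t: "t \<in> {-h..h}"
      show "((\<lambda>t. \<phi> (x + t *\<^sub>R ?e)) has_derivative
              (\<lambda>s. s *\<^sub>R frechet_derivative \<phi> (at (x + t *\<^sub>R ?e)) ?e)) (at t within {-h..h})"
        using has_vector_derivative_line[OF diff] by (simp add: has_vector_derivative_def)
      show "onorm (\<lambda>s. s *\<^sub>R frechet_derivative \<phi> (at (x + t *\<^sub>R ?e)) ?e) \<le> C j"
        using C[OF mem[OF t]] by (intro onorm_le) (simp add: mult.commute[of "C j"] mult_left_mono)
    qed (use h in auto)
    then have "norm (\<phi> (x + h *\<^sub>R ?e) - \<phi> (x - h *\<^sub>R ?e)) \<le> C j * (2 * h)" using h by simp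
    then have "\<bar>(\<phi> (x + h *\<^sub>R ?e) - \<phi> (x - h *\<^sub>R ?e)) $ i\<bar> \<le> C j * (2 * h)"
      using component_le_norm_cart order_trans by blast
    then show ?thesis using h by (simp add: central_gradient_def field_simps)
  qed
  then have "norm (central_gradient h \<phi> x) \<le> (\<Sum>i\<in>(UNIV::3 set). \<Sum>j\<in>(UNIV::3 set). C j)"
    if "x \<in> K" "0 < h" "h \<le> 1" for x h
    using that unfolding norm_vec_def
    by (intro order_trans[OF L2_set_le_sum] sum_mono) (auto simp: L2_set_nonneg)
  then show ?thesis by blast
qed

text \<open>The integrals with central differences are nonnegative, and they converge to the
  integral with the true gradient by dominated convergence.\<close>

theorem rank_one_nonneg_imp_quasiconvex:
  assumes quad: "quadratic_form \<Phi>" and pos: "\<And>x y. 0 \<le> \<Phi> (tensor x y)"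
  shows "quasiconvex \<Phi>"
  unfolding quasiconvex_def
proof (intro allI impI)
  fix Z :: "real^3^3" and \<phi> :: "real^3 \<Rightarrow> real^3"
  assume \<phi>: "test_map \<phi>"
  obtain B where B: "bilinear B" and \<Phi>: "\<Phi> A = B A A" for A
    using quad unfolding quadratic_form_def by blast
  define \<Psi> where "\<Psi> A = B Z A + B A Z + B A A" for A
  have inc: "\<Phi> (Z + A) - \<Phi> Z = \<Psi> A" for A
    by (simp add: \<Phi> \<Psi>_def bilinear_ladd[OF B] bilinear_radd[OF B])
  have cont\<Psi>: "continuous_on UNIV \<Psi>"
    unfolding \<Psi>_def
    by (intro continuous_intros bounded_bilinear.continuous_on[OF bilinear_conv_bounded_bilinear[THEN iffD1, OF B]])
  have "Ck_map (Suc 0) \<phi>" using \<phi> unfolding test_map_def by blast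
  then have diff: "\<phi> differentiable (at x)"
    and contD: "continuous_on UNIV (\<lambda>x. frechet_derivative \<phi> (at x) v)" for x v
    by simp_all
  have cont: "continuous_on UNIV \<phi>"
    by (intro continuous_at_imp_continuous_on ballI differentiable_imp_continuous_within diff)
  obtain R where R: "\<And>x i. \<bar>x $ i\<bar> > R \<Longrightarrow> \<phi> x = 0"
    using \<phi> vanishes_outside_cube[of \<phi>] unfolding test_map_def by metis
  \<comment> \<open>Enlarging the cube by 1 covers the spread of the support for all step sizes
    \<open>h n \<le> 1\<close>, so a single constant \<open>M\<close> on \<open>K\<close> dominates
    every integrand.\<close>
  define K :: "(real^3) set" where "K = cbox (\<chi> i. - (R + 1)) (\<chi> i. R + 1)"
  have K: "compact K" by (simp add: K_def)
  obtain C where C: "\<And>x h. x \<in> K \<Longrightarrow> 0 < h \<Longrightarrow> h \<le> 1 \<Longrightarrow> norm (central_gradient h \<phi> x) \<le> C"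
    using central_gradient_bounded[OF diff contD K] by blast
  have "compact (\<Psi> ` cball 0 C)"
    by (intro compact_continuous_image continuous_on_subset[OF cont\<Psi>]) auto
  then obtain M where "\<forall>b\<in>\<Psi> ` cball 0 C. norm b \<le> M"
    using compact_imp_bounded bounded_iff by metis
  then have M: "\<bar>\<Psi> A\<bar> \<le> M" if "norm A \<le> C" for A
    using that by simp
  define h :: "nat \<Rightarrow> real" where "h n = inverse (Suc n)" for n
  have h: "h n > 0" "h n \<le> 1" for n by (auto simp: h_def field_simps)
  have h0: "h \<longlonglongrightarrow> 0" unfolding h_def by (rule LIMSEQ_inverse_real_of_nat)
  have vanish: "central_gradient (h n) \<phi> x = 0" if "x \<notin> K" for n x
  proof -
    have "\<not> (\<forall>i. \<bar>x $ i\<bar> \<le> R + 1)"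
      using that by (auto simp: K_def mem_box_cart abs_le_iff minus_le_iff)
    then obtain i where "\<bar>x $ i\<bar> > R + 1" by (auto simp: not_le)
    then have "\<phi> (x + h n *\<^sub>R axis j 1) = 0" "\<phi> (x - h n *\<^sub>R axis j 1) = 0" for j
      using h[of n] by (auto intro!: R[where i = i] simp: axis_def)
    then show ?thesis by (simp add: central_gradient_def vec_eq_iff)
  qed
  have lim: "(\<lambda>n. \<Psi> (central_gradient (h n) \<phi> x)) \<longlonglongrightarrow> \<Psi> (jacobian \<phi> (at x))" for x
    using continuous_on_tendsto_compose[OF cont\<Psi> central_gradient_tendsto[OF diff h0 h(1)]] by simp
  have meas: "(\<lambda>x. \<Psi> (central_gradient (h n) \<phi> x)) \<in> borel_measurable borel" for n
    by (rule borel_measurable_continuous_onI,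
        rule continuous_on_compose2[OF cont\<Psi> continuous_on_central_gradient[OF cont]]) simp
  have conv: "(\<lambda>n. LINT x|lborel. \<Psi> (central_gradient (h n) \<phi> x)) \<longlonglongrightarrow> (LINT x|lborel. \<Psi> (jacobian \<phi> (at x)))"
  proof (rule integral_dominated_convergence)
    show "(\<lambda>x. \<Psi> (jacobian \<phi> (at x))) \<in> borel_measurable lborel"
      by (rule borel_measurable_LIMSEQ_real[where u = "\<lambda>n x. \<Psi> (central_gradient (h n) \<phi> x)"])
        (simp_all add: lim meas)
    show "integrable lborel (\<lambda>x. indicator K x *\<^sub>R M)"
      by (intro borel_integrable_compact K) simp
    show "AE x in lborel. norm (\<Psi> (central_gradient (h n) \<phi> x)) \<le> indicator K x *\<^sub>R M" for n
    proof (rule AE_I2)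
      fix x
      show "norm (\<Psi> (central_gradient (h n) \<phi> x)) \<le> indicator K x *\<^sub>R M"
      proof (cases "x \<in> K")
        case True
        then show ?thesis using M[OF C[OF True h]] True by simp
      next
        case False
        then show ?thesis
          by (simp add: vanish \<Psi>_def bilinear_lzero[OF B] bilinear_rzero[OF B])
      qed
    qed
  qed (simp_all add: lim meas)
  have nonneg: "0 \<le> (LINT x|lborel. \<Psi> (central_gradient (h n) \<phi> x))" for n
    unfolding \<Psi>_def
    by (rule integral_central_gradient_nonneg[OF B pos[unfolded \<Phi>] cont h(1) R])
  have "0 \<le> (LINT x|lborel. \<Psi> (jacobian \<phi> (at x)))"
    by (rule LIMSEQ_le_const[OF conv]) (use nonneg in blast)
  then show "0 \<le> (LINT x|lborel. \<Phi> (Z + jacobian \<phi> (at x)) - \<Phi> Z)"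
    by (simp add: inc)
qed

subsection \<open>The example\<close>

text \<open>
  The coefficients of \<open>\<Phi>\<^sub>0\<close> are chosen so that, with \<open>a = y\<^sub>1\<^sup>2\<close>, \<open>b = y\<^sub>2\<^sup>2\<close>, \<open>c = y\<^sub>3\<^sup>2\<close>, the
  determinant of \<open>T\<^sub>0 y\<close> vanishes at \<open>(a, b, c) = (1, 1, 1)\<close>, \<open>(8, 25, 0)\<close>, \<open>(0, 1, 8)\<close> and
  \<open>(1, 0, 0)\<close>. Up to signs and scaling these are 4 + 2 + 2 + 1 = 9 points \<open>y\<close>. One cubic passes
  through all of them; \<open>p\<^sub>0\<close> is its square.
\<close>

definition \<Phi>\<^sub>0 :: "real^3^3 \<Rightarrow> real" where
  "\<Phi>\<^sub>0 Z = 25 * (Z$1$1)\<^sup>2 + (Z$1$2)\<^sup>2 + 24 * (Z$1$3)\<^sup>2 + 25 * (Z$2$1)\<^sup>2 + 64 * (Z$2$2)\<^sup>2 + (Z$2$3)\<^sup>2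
     + 25 * (Z$3$2)\<^sup>2 + 25 * (Z$3$3)\<^sup>2
     - 90 * (Z$1$1 * Z$2$2) - 90 * (Z$2$2 * Z$3$3) - 10 * (Z$1$1 * Z$3$3)"

definition T\<^sub>0 :: "real^3 \<Rightarrow> real^3^3" where
  "T\<^sub>0 y = vector
     [vector [25 * (y$1)\<^sup>2 + (y$2)\<^sup>2 + 24 * (y$3)\<^sup>2, - 45 * (y$1 * y$2), - 5 * (y$1 * y$3)],
      vector [- 45 * (y$1 * y$2), 25 * (y$1)\<^sup>2 + 64 * (y$2)\<^sup>2 + (y$3)\<^sup>2, - 45 * (y$2 * y$3)],
      vector [- 5 * (y$1 * y$3), - 45 * (y$2 * y$3), 25 * (y$2)\<^sup>2 + 25 * (y$3)\<^sup>2]]"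

definition p\<^sub>0 :: "real^3 \<Rightarrow> real" where
  "p\<^sub>0 y = (y$3)\<^sup>2 * (7 * (y$1)\<^sup>2 - 8 * (y$2)\<^sup>2 + (y$3)\<^sup>2)\<^sup>2"

text \<open>By \<open>det_T\<^sub>0\<close> this is what remains of the determinant, divided by 25,
  after \<open>p\<^sub>0\<close> is subtracted. Terms are collected by powers of
  \<open>y$1\<close>.\<close>

definition r\<^sub>0 :: "real^3 \<Rightarrow> real" where
  "r\<^sub>0 y = (625 * (y$2)\<^sup>2 + 551 * (y$3)\<^sup>2) * (y$1)^4
     - 2 * (200 * (y$2)^4 + 1281 * ((y$2)\<^sup>2 * (y$3)\<^sup>2) - 305 * (y$3)^4) * (y$1)\<^sup>2
     + ((y$2)\<^sup>2 + 23 * (y$3)\<^sup>2) * (8 * (y$2)\<^sup>2 - (y$3)\<^sup>2)\<^sup>2"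

lemma det_T\<^sub>0: "det (T\<^sub>0 y) = 25 * p\<^sub>0 y + 25 * r\<^sub>0 y"
  unfolding T\<^sub>0_def p\<^sub>0_def r\<^sub>0_def det_3 vector_3
  by algebra

text \<open>For \<open>\<beta> > 0\<close> the square is completed; otherwise every term is
  nonnegative on the half-line \<open>t \<ge> 0\<close>, so no discriminant bound is asked for
  there.\<close>

lemma quadratic_nonneg:
  fixes \<alpha> \<beta> \<delta> t :: real
  assumes "\<alpha> > 0" "\<delta> \<ge> 0" "t \<ge> 0" and disc: "\<beta> > 0 \<Longrightarrow> \<beta>\<^sup>2 \<le> \<alpha> * \<delta>"
  shows "0 \<le> \<alpha> * t\<^sup>2 - 2 * \<beta> * t + \<delta>"
proof (cases "\<beta> > 0")
  case True
  have "0 \<le> (\<alpha> * t - \<beta>)\<^sup>2 + (\<alpha> * \<delta> - \<beta>\<^sup>2)" using disc[OF True] by simp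
  also have "\<dots> = \<alpha> * (\<alpha> * t\<^sup>2 - 2 * \<beta> * t + \<delta>)" by (simp add: power2_eq_square algebra_simps)
  finally show ?thesis using assms(1) by (simp add: zero_le_mult_iff)
next
  case False
  then have "\<beta> * t \<le> 0" using assms(3) by (simp add: mult_nonpos_nonneg)
  moreover have "0 \<le> \<alpha> * t\<^sup>2" using assms(1) by simp
  ultimately show ?thesis using assms(2) by linarith
qed

text \<open>
  In the squares of the coordinates \<open>r\<^sub>0\<close> is quadratic in the first one. Its discriminant is a
  multiple of \<open>c (b - c)\<^sup>2 (80352 c - 432864 b)\<close>, which is positive only where the linear
  coefficient is positive as well.
\<close>

lemma r\<^sub>0_nonneg_aux:
  fixes a b c :: real
  assumes "a \<ge> 0" "b \<ge> 0" "c \<ge> 0"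
  shows "0 \<le> (625 * b + 551 * c) * a\<^sup>2 - 2 * (200 * b\<^sup>2 + 1281 * (b * c) - 305 * c\<^sup>2) * a
     + (b + 23 * c) * (8 * b - c)\<^sup>2"
proof (cases "b = 0 \<and> c = 0")
  case False
  let ?\<beta> = "200 * b\<^sup>2 + 1281 * (b * c) - 305 * c\<^sup>2"
  show ?thesis
  proof (rule quadratic_nonneg)
    show "0 < 625 * b + 551 * c" using False assms by auto
    assume \<beta>: "?\<beta> > 0"
    have "80352 * c \<le> 432864 * b"
    proof (rule ccontr)
      assume "\<not> ?thesis"
      \<comment> \<open>The ratio of 432864 to 80352 exceeds 5. For \<open>c \<ge> 5 * b\<close> the
        linear coefficient is at most \<open>- 204 * (b * c)\<close>, which contradicts its
        positivity.\<close>
      then have bc: "5 * b \<le> c" using assms by simp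
      then have "0 \<le> (c - 5 * b) * b" "0 \<le> (c - 5 * b) * c"
        using assms by simp_all
      moreover have "0 \<le> b * b" "0 \<le> b * c" using assms by auto
      ultimately show False using \<beta> unfolding power2_eq_square left_diff_distrib
        by (simp only: mult.assoc mult.commute[of c b])
    qed
    then have "0 \<le> c * (b - c)\<^sup>2 * (432864 * b - 80352 * c)"
      using assms by (intro mult_nonneg_nonneg) simp_all
    also have "\<dots> = (625 * b + 551 * c) * ((b + 23 * c) * (8 * b - c)\<^sup>2) - ?\<beta>\<^sup>2"
      by algebra
    finally show "?\<beta>\<^sup>2 \<le> (625 * b + 551 * c) * ((b + 23 * c) * (8 * b - c)\<^sup>2)"
      by (simp only: diff_ge_0_iff_ge)
  qed (use assms in simp_all)
qed simp

lemma r\<^sub>0_nonneg: "0 \<le> r\<^sub>0 y"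
proof -
  have "y$1 ^ 4 = ((y$1)\<^sup>2)\<^sup>2" "y$2 ^ 4 = ((y$2)\<^sup>2)\<^sup>2" "y$3 ^ 4 = ((y$3)\<^sup>2)\<^sup>2" by simp_all
  then show ?thesis
    using r\<^sub>0_nonneg_aux[of "(y$1)\<^sup>2" "(y$2)\<^sup>2" "(y$3)\<^sup>2"] unfolding r\<^sub>0_def by simp
qed

lemma p\<^sub>0_nonneg: "0 \<le> p\<^sub>0 y"
  by (simp add: p\<^sub>0_def)

lemma \<Phi>\<^sub>0_tensor: "\<Phi>\<^sub>0 (tensor x y) = x \<bullet> (T\<^sub>0 y *v x)"
  unfolding \<Phi>\<^sub>0_def T\<^sub>0_def tensor_def inner_vec_def sum_3 matrix_vector_mult_def vec_lambda_beta
    vector_3 inner_real_def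
  by (simp add: power2_eq_square algebra_simps)

section \<open>Closure properties of quadratic forms and homogeneous polynomials\<close>

lemma quadratic_form_cmult:
  assumes "quadratic_form q"
  shows "quadratic_form (\<lambda>z. c * q z)"
proof -
  obtain B where "bilinear B" "\<And>z. q z = B z z"
    using assms unfolding quadratic_form_def by blast
  then show ?thesis
    unfolding quadratic_form_def bilinear_def
    by (intro exI[of _ "\<lambda>x y. c * B x y"]) (auto simp: linear_iff algebra_simps)
qed

lemma quadratic_form_add:
  assumes "quadratic_form p" "quadratic_form q"
  shows "quadratic_form (\<lambda>z. p z + q z)"
proof -
  obtain A B where "bilinear A" "\<And>z. p z = A z z" "bilinear B" "\<And>z. q z = B z z"
    using assms unfolding quadratic_form_def by blast
  then show ?thesis
    unfolding quadratic_form_def bilinear_def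
    by (intro exI[of _ "\<lambda>x y. A x y + B x y"]) (auto simp: linear_iff algebra_simps)
qed

lemma quadratic_form_diff:
  assumes "quadratic_form p" "quadratic_form q"
  shows "quadratic_form (\<lambda>z. p z - q z)"
  using quadratic_form_add[OF assms(1) quadratic_form_cmult[OF assms(2), of "- 1"]] by simp

lemma quadratic_form_mult:
  fixes f g :: "'a::real_vector \<Rightarrow> real"
  assumes "linear f" "linear g"
  shows "quadratic_form (\<lambda>z. f z * g z)"
  unfolding quadratic_form_def bilinear_def
  using assms by (intro exI[of _ "\<lambda>x y. f x * g y"]) (auto simp: linear_iff algebra_simps)

lemma homogeneous_poly_add:
  assumes "homogeneous_poly d f" "homogeneous_poly d g"
  shows "homogeneous_poly d (\<lambda>y. f y + g y)"
proof -
  from assms(1) obtain a where a: "\<forall>y. f y = (\<Sum>\<alpha> | (\<Sum>i\<in>UNIV. \<alpha> i) = d. a \<alpha> * (\<Prod>i\<in>UNIV. y $ i ^ \<alpha> i))"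
    unfolding homogeneous_poly_def by (rule exE)
  from assms(2) obtain b where b: "\<forall>y. g y = (\<Sum>\<alpha> | (\<Sum>i\<in>UNIV. \<alpha> i) = d. b \<alpha> * (\<Prod>i\<in>UNIV. y $ i ^ \<alpha> i))"
    unfolding homogeneous_poly_def by (rule exE)
  show ?thesis unfolding homogeneous_poly_def
    by (rule exI[of _ "\<lambda>\<alpha>. a \<alpha> + b \<alpha>"]) (simp add: a b distrib_right sum.distrib)
qed

lemma homogeneous_poly_scale:
  assumes "homogeneous_poly d f"
  shows "homogeneous_poly d (\<lambda>y. c * f y)"
proof -
  from assms obtain a where a: "\<forall>y. f y = (\<Sum>\<alpha> | (\<Sum>i\<in>UNIV. \<alpha> i) = d. a \<alpha> * (\<Prod>i\<in>UNIV. y $ i ^ \<alpha> i))"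
    unfolding homogeneous_poly_def by (rule exE)
  show ?thesis unfolding homogeneous_poly_def
    by (rule exI[of _ "\<lambda>\<alpha>. c * a \<alpha>"]) (simp add: a sum_distrib_left mult.assoc)
qed

lemma homogeneous_poly_monomial:
  fixes \<alpha> :: "'n::finite \<Rightarrow> nat"
  assumes "(\<Sum>i\<in>UNIV. \<alpha> i) = d"
  shows "homogeneous_poly d (\<lambda>y. \<Prod>i\<in>UNIV. y $ i ^ \<alpha> i)"
  unfolding homogeneous_poly_def
proof (intro exI allI)
  fix y :: "real^'n"
  show "(\<Prod>i\<in>UNIV. y $ i ^ \<alpha> i) =
    (\<Sum>\<beta> | (\<Sum>i\<in>UNIV. \<beta> i) = d. (if \<beta> = \<alpha> then 1 else 0) * (\<Prod>i\<in>UNIV. y $ i ^ \<beta> i))"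
    using assms by (simp add: if_distrib[of "\<lambda>x. x * _"] finite_multi_indices cong: if_cong)
qed

lemma homogeneous_poly_monomial_3:
  assumes "i + j + k = d"
  shows "homogeneous_poly d (\<lambda>y :: real^3. y$1 ^ i * y$2 ^ j * y$3 ^ k)"
proof -
  define \<alpha> :: "3 \<Rightarrow> nat" where "\<alpha> l = (if l = 1 then i else if l = 2 then j else k)" for l
  have "(\<Sum>l\<in>UNIV. \<alpha> l) = d"
    using assms unfolding UNIV_3 by (simp add: \<alpha>_def)
  moreover have "(\<Prod>l\<in>UNIV. y $ l ^ \<alpha> l) = y$1 ^ i * y$2 ^ j * y$3 ^ k" for y :: "real^3"
    unfolding UNIV_3 by (simp add: \<alpha>_def)
  ultimately show ?thesis
    using homogeneous_poly_monomial[of \<alpha> d] by (simp only:)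
qed

text \<open>Completing the square in \<open>x\<close> leaves a binary form in \<open>y\<close> and
  \<open>z\<close> whose coefficients are 2 by 2 minors and whose determinant is \<open>p\<close>
  times the full determinant. If its first coefficient vanishes, so does the mixed one, and
  \<open>m3\<close> settles the rest.\<close>

lemma quadratic_form_3_nonneg:
  fixes p q r u v w x y z :: real
  assumes p: "p > 0" and m2: "0 \<le> p * q - u\<^sup>2" and m3: "0 \<le> p * r - v\<^sup>2"
    and det: "0 \<le> p * q * r + 2 * u * v * w - p * w\<^sup>2 - q * v\<^sup>2 - r * u\<^sup>2"
  shows "0 \<le> p * x\<^sup>2 + q * y\<^sup>2 + r * z\<^sup>2 + 2 * u * (x * y) + 2 * v * (x * z) + 2 * w * (y * z)" (is "0 \<le> ?f")
proof -
  define a b c d where "a = p * q - u\<^sup>2" "b = p * r - v\<^sup>2" "c = p * w - u * v"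
    "d = p * q * r + 2 * u * v * w - p * w\<^sup>2 - q * v\<^sup>2 - r * u\<^sup>2"
  note defs = this
  have pd: "a * b - c\<^sup>2 = p * d" unfolding defs by algebra
  have "0 \<le> a * y\<^sup>2 + 2 * c * (y * z) + b * z\<^sup>2" (is "0 \<le> ?g")
  proof (cases "a = 0")
    case True
    have "0 \<le> p * d" using p det unfolding defs by simp
    moreover have "0 \<le> c\<^sup>2" by simp
    moreover have "- c\<^sup>2 = p * d" using pd True by simp
    ultimately have "c\<^sup>2 = 0" by linarith
    then have "c = 0" by simp
    then show ?thesis using True m3 unfolding defs by simp
  next
    case False
    then have a: "a > 0" using m2 unfolding defs by simp
    have "a * ?g = (a * y + c * z)\<^sup>2 + p * d * z\<^sup>2" unfolding pd[symmetric] by algebra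
    also have "\<dots> \<ge> 0" using p det unfolding defs by simp
    finally show ?thesis using a by (simp add: zero_le_mult_iff)
  qed
  moreover have "p * ?f = (p * x + u * y + v * z)\<^sup>2 + ?g" unfolding defs by algebra
  ultimately have "0 \<le> p * ?f" by simp
  then show ?thesis using p by (simp add: zero_le_mult_iff)
qed

text \<open>Positive semidefiniteness of \<open>T\<^sub>0 y\<close> is read off from its minors; the
  determinant is nonnegative as a sum of multiples of \<open>p\<^sub>0\<close> and
  \<open>r\<^sub>0\<close>.\<close>

lemma \<Phi>\<^sub>0_tensor_nonneg: "0 \<le> \<Phi>\<^sub>0 (tensor x y)"
proof (cases "y = 0")
  case True
  then show ?thesis by (simp add: \<Phi>\<^sub>0_def tensor_def)
next
  case False
  define a b c where "a = (y$1)\<^sup>2" "b = (y$2)\<^sup>2" "c = (y$3)\<^sup>2"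
  note abc = this
  have nn: "0 \<le> a" "0 \<le> b" "0 \<le> c" "0 \<le> a * b" "0 \<le> a * c" "0 \<le> b * c" "0 \<le> b * b" "0 \<le> c * c"
    by (simp_all add: abc)
  have "a \<noteq> 0 \<or> b \<noteq> 0 \<or> c \<noteq> 0" using False by (simp add: abc vec_eq_iff forall_3)
  then have pos: "0 < 25 * a + b + 24 * c" using nn by linarith
  let ?u = "- 45 * (y$1 * y$2)" and ?v = "- 5 * (y$1 * y$3)" and ?w = "- 45 * (y$2 * y$3)"
  let ?p = "25 * a + b + 24 * c" and ?q = "25 * a + 64 * b + c" and ?r = "25 * b + 25 * c"
  \<comment> \<open>This minor vanishes when \<open>(a, b, c)\<close> is proportional to (8, 25, 0),
    so the degenerate case of \<open>quadratic_form_3_nonneg\<close> does occur.\<close>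
  have "?p * ?q - ?u\<^sup>2 = (25 * a - 8 * b)\<^sup>2 + 625 * (a * c) + 1537 * (b * c) + 24 * (c * c)"
    unfolding abc by algebra
  also have "\<dots> \<ge> 0" using nn by simp
  finally have m2: "0 \<le> ?p * ?q - ?u\<^sup>2" .
  have "?p * ?r - ?v\<^sup>2 = 625 * (a * b) + 600 * (a * c) + 25 * (b * b) + 625 * (b * c) + 600 * (c * c)"
    unfolding abc by algebra
  also have "\<dots> \<ge> 0" using nn by simp
  finally have m3: "0 \<le> ?p * ?r - ?v\<^sup>2" .
  have "?p * ?q * ?r + 2 * ?u * ?v * ?w - ?p * ?w\<^sup>2 - ?q * ?v\<^sup>2 - ?r * ?u\<^sup>2 = det (T\<^sub>0 y)"
    unfolding T\<^sub>0_def det_3 vector_3 abc by algebra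
  also have "\<dots> \<ge> 0" using p\<^sub>0_nonneg[of y] r\<^sub>0_nonneg[of y] by (simp add: det_T\<^sub>0)
  finally have det: "0 \<le> ?p * ?q * ?r + 2 * ?u * ?v * ?w - ?p * ?w\<^sup>2 - ?q * ?v\<^sup>2 - ?r * ?u\<^sup>2" .
  have "\<Phi>\<^sub>0 (tensor x y) = ?p * (x$1)\<^sup>2 + ?q * (x$2)\<^sup>2 + ?r * (x$3)\<^sup>2
     + 2 * ?u * (x$1 * x$2) + 2 * ?v * (x$1 * x$3) + 2 * ?w * (x$2 * x$3)"
    unfolding \<Phi>\<^sub>0_def tensor_def abc vec_lambda_beta by (simp add: power2_eq_square algebra_simps)
  also have "\<dots> \<ge> 0" using pos m2 m3 det by (rule quadratic_form_3_nonneg)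
  finally show ?thesis .
qed

lemma linear_entry: "linear (\<lambda>Z :: real^'n^'m. Z $ i $ j)"
  by (simp add: linear_iff)

lemma quadratic_form_\<Phi>\<^sub>0: "quadratic_form \<Phi>\<^sub>0"
proof -
  have q1: "quadratic_form (\<lambda>Z :: real^3^3. Z$i$j * Z$k$l)" for i j k l
    by (intro quadratic_form_mult linear_entry)
  then have q: "quadratic_form (\<lambda>Z :: real^3^3. c * (Z$i$j * Z$k$l))" for c i j k l
    by (rule quadratic_form_cmult)
  show ?thesis
    unfolding \<Phi>\<^sub>0_def[abs_def] power2_eq_square
    by (rule quadratic_form_add quadratic_form_diff q q1)+
qed

lemma is_acoustic_tensor_T\<^sub>0: "is_acoustic_tensor \<Phi>\<^sub>0 T\<^sub>0"
proof -
  have q: "quadratic_form (\<lambda>y :: real^3. c * (y$i * y$j))" for c i j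
    by (rule quadratic_form_cmult, rule quadratic_form_mult) (simp_all add: linear_iff)
  have q1: "quadratic_form (\<lambda>y :: real^3. y$i * y$j)" for i j using q[of 1] by simp
  have "quadratic_form (\<lambda>y. T\<^sub>0 y $ i $ j)" for i j
  proof -
    have "\<forall>i j. quadratic_form (\<lambda>y. T\<^sub>0 y $ i $ j)"
      unfolding forall_3 T\<^sub>0_def vector_3 power2_eq_square
      by (rule conjI quadratic_form_add q q1)+
    then show ?thesis by blast
  qed
  moreover have "transpose (T\<^sub>0 y) = T\<^sub>0 y" for y
    by (simp add: T\<^sub>0_def transpose_def vec_eq_iff forall_3)
  ultimately show ?thesis
    unfolding is_acoustic_tensor_def by (simp add: \<Phi>\<^sub>0_tensor)
qed

text \<open>Each zero of \<open>\<Phi>\<^sub>0\<close> on rank-one matrices gives a linear equation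
  for the entries of \<open>M\<close>. The vector \<open>x\<close> paired with each of the nine
  points \<open>y\<close> spans the kernel of \<open>T\<^sub>0 y\<close>, and the nine equations
  force \<open>M = 0\<close>.\<close>

lemma \<Phi>\<^sub>0_no_square_below:
  assumes "\<And>x y. (x \<bullet> (M *v y))\<^sup>2 \<le> \<Phi>\<^sub>0 (tensor x y)"
  shows "M = 0"
proof -
  \<comment> \<open>The points with squares (8, 25, 0) and (0, 1, 8) have a coordinate equal to the
    square root of 8.\<close>
  define s where "s = sqrt 8"
  have s: "s * s = 8" "s \<noteq> 0" "s * (s * t) = 8 * t" for t
    by (simp_all add: s_def flip: mult.assoc)
  have Z: "x \<bullet> (M *v y) = 0" if "\<Phi>\<^sub>0 (tensor x y) = 0" for x y
    using assms[of x y] that by simp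
  have I: "x \<bullet> (M *v y) = x$1 * (M$1$1 * y$1 + M$1$2 * y$2 + M$1$3 * y$3) +
     x$2 * (M$2$1 * y$1 + M$2$2 * y$2 + M$2$3 * y$3) + x$3 * (M$3$1 * y$1 + M$3$2 * y$2 + M$3$3 * y$3)" for x y
    by (simp add: inner_vec_def sum_3 matrix_vector_mult_def)
  note zero = Z[unfolded I \<Phi>\<^sub>0_def tensor_def vec_lambda_beta]
  note simps = s power2_eq_square algebra_simps
  have 1: "M$1$1 + M$1$2 + M$1$3 + M$2$1 + M$2$2 + M$2$3 + M$3$1 + M$3$2 + M$3$3 = 0"
    using zero[of "vector [1, 1, 1]" "vector [1, 1, 1]"] by (simp add: simps)
  have 2: "M$1$1 - M$1$2 - M$1$3 - M$2$1 + M$2$2 + M$2$3 - M$3$1 + M$3$2 + M$3$3 = 0"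
    using zero[of "vector [-1, 1, 1]" "vector [-1, 1, 1]"] by (simp add: simps)
  have 3: "M$1$1 - M$1$2 + M$1$3 - M$2$1 + M$2$2 - M$2$3 + M$3$1 - M$3$2 + M$3$3 = 0"
    using zero[of "vector [1, -1, 1]" "vector [1, -1, 1]"] by (simp add: simps)
  have 4: "M$1$1 + M$1$2 - M$1$3 + M$2$1 + M$2$2 - M$2$3 - M$3$1 - M$3$2 + M$3$3 = 0"
    using zero[of "vector [1, 1, -1]" "vector [1, 1, -1]"] by (simp add: simps)
  have 5: "8 * M$1$1 + 5 * s * M$1$2 + s * M$2$1 + 5 * M$2$2 = 0"
    using zero[of "vector [s, 1, 0]" "vector [s, 5, 0]"] by (simp add: simps)
  have 6: "8 * M$1$1 - 5 * s * M$1$2 - s * M$2$1 + 5 * M$2$2 = 0"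
    using zero[of "vector [s, -1, 0]" "vector [s, -5, 0]"] by (simp add: simps)
  have 7: "5 * M$2$2 + 5 * s * M$2$3 + s * M$3$2 + 8 * M$3$3 = 0"
    using zero[of "vector [0, 5, s]" "vector [0, 1, s]"] by (simp add: simps)
  have 8: "5 * M$2$2 - 5 * s * M$2$3 - s * M$3$2 + 8 * M$3$3 = 0"
    using zero[of "vector [0, 5, -s]" "vector [0, 1, -s]"] by (simp add: simps)
  have 9: "M$3$1 = 0"
    using zero[of "vector [0, 0, 1]" "vector [1, 0, 0]"] by (simp add: simps)
  \<comment> \<open>Signed sums of the first four equations isolate the trace and the sums of
    opposite off-diagonal entries.\<close>
  have diag: "M$1$1 + M$2$2 + M$3$3 = 0"
    and "M$1$2 + M$2$1 = 0" "M$1$3 + M$3$1 = 0" "M$2$3 + M$3$2 = 0"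
    using 1 2 3 4 by linarith+
  \<comment> \<open>Subtracting the equations of a sign pair isolates the off-diagonal entries,
    while adding them isolates the diagonal ones. The weights 5 and 1 differ from those of the
    antisymmetry relations, so the off-diagonal entries vanish.\<close>
  moreover have "s * (5 * M$1$2 + M$2$1) = 0" "s * (5 * M$2$3 + M$3$2) = 0"
    using 5 6 7 8 by (simp_all only: distrib_left mult.assoc mult.left_commute[of s 5])
  then have "5 * M$1$2 + M$2$1 = 0" "5 * M$2$3 + M$3$2 = 0"
    using s(2) by (simp_all only: mult_eq_0_iff simp_thms)
  moreover have "8 * M$1$1 + 5 * M$2$2 = 0" using 5 6 by linarith
  moreover have "5 * M$2$2 + 8 * M$3$3 = 0" using 7 8 by linarith
  ultimately have "M$1$1 = 0" "M$1$2 = 0" "M$1$3 = 0" "M$2$1 = 0" "M$2$2 = 0" "M$2$3 = 0"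
    "M$3$2 = 0" "M$3$3 = 0"
    using 9 by linarith+
  then show "M = 0" using 9 by (simp add: vec_eq_iff forall_3)
qed

section \<open>Splitting the determinant into two independent nonnegative sextics\<close>

lemma nonneg_ternary_sextic_p\<^sub>0: "nonneg_ternary_sextic (\<lambda>y. 25 * p\<^sub>0 y)"
proof -
  \<comment> \<open>Zero exponents and the coefficient 1 are written out so that every summand is a
    scaled monomial in the shape of \<open>homogeneous_poly_monomial_3\<close>.\<close>
  have "c\<^sup>2 * (7 * a\<^sup>2 - 8 * b\<^sup>2 + c\<^sup>2)\<^sup>2
    =
      49 * (a ^ 4 * b ^ 0 * c ^ 2) + 64 * (a ^ 0 * b ^ 4 * c ^ 2)
      + 1 * (a ^ 0 * b ^ 0 * c ^ 6) + (- 112) * (a ^ 2 * b ^ 2 * c ^ 2)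
      + 14 * (a ^ 2 * b ^ 0 * c ^ 4) + (- 16) * (a ^ 0 * b ^ 2 * c ^ 4)" for a b c :: real
    by algebra
  then have "p\<^sub>0 = (\<lambda>y.
      49 * (y$1 ^ 4 * y$2 ^ 0 * y$3 ^ 2) + 64 * (y$1 ^ 0 * y$2 ^ 4 * y$3 ^ 2)
      + 1 * (y$1 ^ 0 * y$2 ^ 0 * y$3 ^ 6) + (- 112) * (y$1 ^ 2 * y$2 ^ 2 * y$3 ^ 2)
      + 14 * (y$1 ^ 2 * y$2 ^ 0 * y$3 ^ 4) + (- 16) * (y$1 ^ 0 * y$2 ^ 2 * y$3 ^ 4))"
    by (intro ext) (simp only: p\<^sub>0_def)
  moreover have "homogeneous_poly 6 (\<lambda>y :: real^3.
      49 * (y$1 ^ 4 * y$2 ^ 0 * y$3 ^ 2) + 64 * (y$1 ^ 0 * y$2 ^ 4 * y$3 ^ 2)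
      + 1 * (y$1 ^ 0 * y$2 ^ 0 * y$3 ^ 6) + (- 112) * (y$1 ^ 2 * y$2 ^ 2 * y$3 ^ 2)
      + 14 * (y$1 ^ 2 * y$2 ^ 0 * y$3 ^ 4) + (- 16) * (y$1 ^ 0 * y$2 ^ 2 * y$3 ^ 4))"
    by (rule homogeneous_poly_add homogeneous_poly_scale homogeneous_poly_monomial_3 | (simp; fail))+
  ultimately have "homogeneous_poly 6 p\<^sub>0" by (simp only:)
  then have "homogeneous_poly 6 (\<lambda>y. 25 * p\<^sub>0 y)" by (rule homogeneous_poly_scale)
  then show ?thesis
    using p\<^sub>0_nonneg by (simp add: nonneg_ternary_sextic_def)
qed

lemma nonneg_ternary_sextic_r\<^sub>0: "nonneg_ternary_sextic (\<lambda>y. 25 * r\<^sub>0 y)"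
proof -
  have "(625 * b\<^sup>2 + 551 * c\<^sup>2) * a^4
     - 2 * (200 * b^4 + 1281 * (b\<^sup>2 * c\<^sup>2) - 305 * c^4) * a\<^sup>2
     + (b\<^sup>2 + 23 * c\<^sup>2) * (8 * b\<^sup>2 - c\<^sup>2)\<^sup>2
    =
      625 * (a ^ 4 * b ^ 2 * c ^ 0) + 551 * (a ^ 4 * b ^ 0 * c ^ 2)
      + (- 400) * (a ^ 2 * b ^ 4 * c ^ 0) + (- 2562) * (a ^ 2 * b ^ 2 * c ^ 2)
      + 610 * (a ^ 2 * b ^ 0 * c ^ 4) + 64 * (a ^ 0 * b ^ 6 * c ^ 0)
      + 1456 * (a ^ 0 * b ^ 4 * c ^ 2) + (- 367) * (a ^ 0 * b ^ 2 * c ^ 4)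
      + 23 * (a ^ 0 * b ^ 0 * c ^ 6)" for a b c :: real
    by algebra
  then have "r\<^sub>0 = (\<lambda>y.
      625 * (y$1 ^ 4 * y$2 ^ 2 * y$3 ^ 0) + 551 * (y$1 ^ 4 * y$2 ^ 0 * y$3 ^ 2)
      + (- 400) * (y$1 ^ 2 * y$2 ^ 4 * y$3 ^ 0) + (- 2562) * (y$1 ^ 2 * y$2 ^ 2 * y$3 ^ 2)
      + 610 * (y$1 ^ 2 * y$2 ^ 0 * y$3 ^ 4) + 64 * (y$1 ^ 0 * y$2 ^ 6 * y$3 ^ 0)
      + 1456 * (y$1 ^ 0 * y$2 ^ 4 * y$3 ^ 2) + (- 367) * (y$1 ^ 0 * y$2 ^ 2 * y$3 ^ 4)
      + 23 * (y$1 ^ 0 * y$2 ^ 0 * y$3 ^ 6))"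
    by (intro ext) (simp only: r\<^sub>0_def)
  moreover have "homogeneous_poly 6 (\<lambda>y :: real^3.
      625 * (y$1 ^ 4 * y$2 ^ 2 * y$3 ^ 0) + 551 * (y$1 ^ 4 * y$2 ^ 0 * y$3 ^ 2)
      + (- 400) * (y$1 ^ 2 * y$2 ^ 4 * y$3 ^ 0) + (- 2562) * (y$1 ^ 2 * y$2 ^ 2 * y$3 ^ 2)
      + 610 * (y$1 ^ 2 * y$2 ^ 0 * y$3 ^ 4) + 64 * (y$1 ^ 0 * y$2 ^ 6 * y$3 ^ 0)
      + 1456 * (y$1 ^ 0 * y$2 ^ 4 * y$3 ^ 2) + (- 367) * (y$1 ^ 0 * y$2 ^ 2 * y$3 ^ 4)
      + 23 * (y$1 ^ 0 * y$2 ^ 0 * y$3 ^ 6))"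
    by (rule homogeneous_poly_add homogeneous_poly_scale homogeneous_poly_monomial_3 | (simp; fail))+
  ultimately have "homogeneous_poly 6 r\<^sub>0" by (simp only:)
  then have "homogeneous_poly 6 (\<lambda>y. 25 * r\<^sub>0 y)" by (rule homogeneous_poly_scale)
  then show ?thesis
    using r\<^sub>0_nonneg by (simp add: nonneg_ternary_sextic_def)
qed

lemma not_spans_extreme_ray_det_T\<^sub>0: "\<not> spans_extreme_ray (\<lambda>y. det (T\<^sub>0 y))"
proof
  assume "spans_extreme_ray (\<lambda>y. det (T\<^sub>0 y))"
  then have "lin_dependent (\<lambda>y. 25 * p\<^sub>0 y) (\<lambda>y. 25 * r\<^sub>0 y)"
    unfolding spans_extreme_ray_def
    using det_T\<^sub>0 nonneg_ternary_sextic_p\<^sub>0 nonneg_ternary_sextic_r\<^sub>0 by blast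
  then obtain a b where ab: "a \<noteq> 0 \<or> b \<noteq> 0" and *: "\<And>y. a * (25 * p\<^sub>0 y) + b * (25 * r\<^sub>0 y) = 0"
    unfolding lin_dependent_def by blast
  \<comment> \<open>At (0, 1, 0) only \<open>r\<^sub>0\<close> is nonzero, so \<open>b = 0\<close>;
    at (0, 0, 1) the value of \<open>p\<^sub>0\<close> is 1, so \<open>a = 0\<close>.\<close>
  show False
    using ab *[of "vector [0, 1, 0]"] *[of "vector [0, 0, 1]"] by (simp add: p\<^sub>0_def r\<^sub>0_def)
qed

theorem theorem1p3:
  shows "\<exists>(\<Phi> :: real^3^3 \<Rightarrow> real) (T :: real^3 \<Rightarrow> real^3^3).
           quadratic_form \<Phi> \<and> quasiconvex \<Phi> \<and> weak_extremal \<Phi> \<and>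
           is_acoustic_tensor \<Phi> T \<and> \<not> spans_extreme_ray (\<lambda>y. det (T y))"
proof (intro exI conjI)
  show quasi: "quasiconvex \<Phi>\<^sub>0"
    using quadratic_form_\<Phi>\<^sub>0 \<Phi>\<^sub>0_tensor_nonneg by (rule rank_one_nonneg_imp_quasiconvex)
  show "weak_extremal \<Phi>\<^sub>0"
    unfolding weak_extremal_def
    using quadratic_form_\<Phi>\<^sub>0 quasi \<Phi>\<^sub>0_no_square_below by blast
qed (fact quadratic_form_\<Phi>\<^sub>0 is_acoustic_tensor_T\<^sub>0 not_spans_extreme_ray_det_T\<^sub>0)+

end
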